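(* Let $(c_i)_{i\in\mathbb{Z}}$ be a family of complex numbers or of commuting formal variables, and let $\tau_k^{(\alpha)}$ ($k,\alpha\in\mathbb{Z}$) be the associated $\widehat{GL_2}$ tau-functions. Then for all integers $k\ge 0$ and all $\alpha\in\mathbb{Z}$, $$\tau_{k}^{(\alpha)}\,\tau_{k-2}^{(\alpha+2)}=\tau_{k-1}^{(\alpha+2)}\,\tau_{k-1}^{(\alpha)}-\bigl(\tau_{k-1}^{(\alpha+1)}\bigr)^2 .$$
   Context: For $\alpha\in\mathbb{Z}$ put $C^{(\alpha)}(z)=\sum_{i\in\mathbb{Z}} c_{i+\alpha}\,z^{-i-1}$. The $\widehat{GL_2}$ tau-functions $\tau_k^{(\alpha)}$, $k,\alpha\in\mathbb{Z}$, arise as matrix elements $\langle T^k v_0, g_C^{(\alpha)} v_0\rangle$ on two-component fermionic Fock space, where $v_0$ is the vacuum vector, $T$ is a lift of the matrix $\mathrm{diag}(z,z^{-1})$ to the central extension $\widehat{GL_2}$ of the loop group, and $g_C^{(\alpha)}$ is a lift of $\begin{bmatrix}1&0\\ C^{(\alpha)}(z)&1\end{bmatrix}$. They are given explicitly by: (i) $\tau_k^{(\alpha)}=0$ for $k<0$; (ii) $\tau_0^{(\alpha)}=1$; (iii) for $k>0$, $$\tau_k^{(\alpha)}=\frac{1}{k!}\operatorname{Res}_{w_1}\cdots\operatorname{Res}_{w_k}\Bigl(\prod_{1\le i<j\le k}(w_i-w_j)^2\prod_{i=1}^k C^{(\alpha)}(w_i)\Bigr)=\det\bigl[c_{\alpha+i+j}\bigr]_{0\le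 i,j\le k-1},$$ where $\operatorname{Res}_{w}$ denotes the coefficient of $w^{-1}$. These explicit formulas may be taken as the definition of $\tau_k^{(\alpha)}$. *)

theory Defs
  imports Complex_Main "HOL-Library.Poly_Mapping"
begin

text \<open>
  Coefficient rings: commutative rings in which every positive integer is invertible, so that
  division by factorials makes sense. The instances below cover the complex numbers and
  polynomial rings over them. In particular \<open>(int \<Rightarrow>\<^sub>0 nat) \<Rightarrow>\<^sub>0 complex\<close> is the polynomial ring
  over the complex numbers in commuting variables indexed by the integers; the variable with
  index \<open>i\<close> is \<open>Poly_Mapping.single (Poly_Mapping.single i 1) 1\<close>.
\<close>

class comm_rat_algebra = comm_ring_1 +
  assumes of_nat_Suc_dvd_one: "of_nat (Suc n) dvd 1"

instance complex :: comm_rat_algebra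
proof
  fix n :: nat
  have "of_nat (Suc n) \<noteq> (0::complex)"
    by (simp only: of_nat_eq_0_iff nat.distinct not_False_eq_True)
  then show "of_nat (Suc n) dvd (1::complex)"
    by (simp add: dvd_field_iff)
qed

instance poly_mapping :: (comm_monoid_add, comm_rat_algebra) comm_rat_algebra
proof
  fix n :: nat
  obtain u :: 'b where u: "1 = of_nat (Suc n) * u"
    using of_nat_Suc_dvd_one by (rule dvdE)
  have "of_nat (Suc n) * Poly_Mapping.single 0 u
      = Poly_Mapping.single (0::'a) (of_nat (Suc n) * u)"
    by (simp only: single_of_nat [symmetric] mult_single add_0_left)
  also have "\<dots> = 1"
    by (simp only: u [symmetric] single_one)
  finally show "of_nat (Suc n) dvd (1 :: 'a \<Rightarrow>\<^sub>0 'b)"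
    by (metis dvd_triv_left)
qed

definition inverse_of_nat :: "nat \<Rightarrow> 'a::comm_rat_algebra" where
  "inverse_of_nat n = (THE u. of_nat n * u = 1)"

text \<open>
  A monomial in the variables \<open>w\<^sub>i\<close> with integer exponents is an element of \<open>nat \<Rightarrow>\<^sub>0 int\<close>.
  Laurent polynomials are finitely supported families of coefficients of monomials, formal
  distributions are arbitrary ones; the latter form a module over the former.
\<close>

type_synonym 'a laurent_poly = "(nat \<Rightarrow>\<^sub>0 int) \<Rightarrow>\<^sub>0 'a"
type_synonym 'a formal_dist = "(nat \<Rightarrow>\<^sub>0 int) \<Rightarrow> 'a"

definition wvar :: "nat \<Rightarrow> 'a::comm_ring_1 laurent_poly" where
  "wvar i = Poly_Mapping.single (Poly_Mapping.single i 1) 1"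

definition dist_mult :: "'a::comm_ring_1 laurent_poly \<Rightarrow> 'a formal_dist \<Rightarrow> 'a formal_dist" where
  "dist_mult p F = (\<lambda>e. \<Sum>d\<in>Poly_Mapping.keys p. Poly_Mapping.lookup p d * F (e - d))"

text \<open>\<open>f(w\<^sub>1) \<cdots> f(w\<^sub>k)\<close>, where \<open>f n\<close> is the coefficient of \<open>z\<^sup>n\<close> in a formal distribution \<open>f(z)\<close>.\<close>

definition dist_prod :: "nat \<Rightarrow> (int \<Rightarrow> 'a) \<Rightarrow> 'a::comm_ring_1 formal_dist" where
  "dist_prod k f = (\<lambda>e. if Poly_Mapping.keys e \<subseteq> {1..k}
     then \<Prod>i=1..k. f (Poly_Mapping.lookup e i) else 0)"

text \<open>The coefficient of \<open>w\<^sub>i\<^sup>-\<^sup>1\<close>, as a formal distribution that no longer involves \<open>w\<^sub>i\<close>.\<close>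

definition res :: "nat \<Rightarrow> 'a::comm_ring_1 formal_dist \<Rightarrow> 'a formal_dist" where
  "res i F = (\<lambda>e. if Poly_Mapping.lookup e i = 0
     then F (e + Poly_Mapping.single i (-1)) else 0)"

text \<open>\<open>Res\<^bsub>w\<^sub>1\<^esub> \<cdots> Res\<^bsub>w\<^sub>k\<^esub> F\<close> for \<open>F\<close> in the variables \<open>w\<^sub>1, \<dots>, w\<^sub>k\<close>; the result is a constant,
  read off at the trivial monomial.\<close>

definition iterated_res :: "nat \<Rightarrow> 'a::comm_ring_1 formal_dist \<Rightarrow> 'a" where
  "iterated_res k F = foldr res [1..<Suc k] F 0"

text \<open>The coefficients of \<open>C\<^sup>(\<^sup>\<alpha>\<^sup>)(z) = \<Sum>\<^sub>i c\<^bsub>i+\<alpha>\<^esub> z\<^sup>-\<^sup>i\<^sup>-\<^sup>1\<close>: the exponent \<open>n\<close> belongs to \<open>i = - n - 1\<close>.\<close>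

definition Cseries :: "(int \<Rightarrow> 'a) \<Rightarrow> int \<Rightarrow> int \<Rightarrow> 'a" where
  "Cseries c \<alpha> = (\<lambda>n. c ((- n - 1) + \<alpha>))"

definition tau :: "(int \<Rightarrow> 'a::comm_rat_algebra) \<Rightarrow> int \<Rightarrow> int \<Rightarrow> 'a" where
  "tau c \<alpha> k =
    (if k < 0 then 0
     else if k = 0 then 1
     else inverse_of_nat (fact (nat k)) *
       iterated_res (nat k)
         (dist_mult (\<Prod>(i, j)\<in>{(i, j). 1 \<le> i \<and> i < j \<and> j \<le> nat k}. (wvar i - wvar j)\<^sup>2)
           (dist_prod (nat k) (Cseries c \<alpha>))))"

end

theory Submission
  imports Defs "Jordan_Normal_Form.Char_Poly"
begin

text \<open>
  The tau-functions are Hankel determinants, \<open>\<tau>\<^sub>k\<^sup>(\<^sup>\<alpha>\<^sup>) = det [c\<^bsub>\<alpha>+i+j\<^esub>]\<close> with \<open>0 \<le> i, j < k\<close>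
  (\<open>tau_eq_hankel_det\<close>). Indeed the product of the squared differences is the square of a
  Vandermonde determinant (\<open>det_vandermonde\<close>). Expanding both factors over permutations and taking
  residues, each monomial \<open>\<Prod>i. w\<^sub>i\<^bsup>n i\<^esup>\<close> contributes \<open>\<Prod>i. c\<^bsub>\<alpha>+n i\<^esub>\<close>, and the double sum over
  permutations collapses to \<open>k!\<close> times the Hankel determinant (\<open>moment_functional_det_square\<close>).

  For \<open>k \<ge> 2\<close> the recursion is then the Desnanot--Jacobi identity (\<open>desnanot_jacobi\<close>) for the
  Hankel matrix: deleting its first row and column shifts \<open>\<alpha>\<close> by 2, deleting the last ones does
  not shift \<open>\<alpha>\<close>, deleting one of each kind shifts it by 1, and the interior minor is
  \<open>\<tau>\<^bsub>k-2\<^esub>\<^sup>(\<^sup>\<alpha>\<^sup>+\<^sup>2\<^sup>)\<close>. As the coefficient ring may have zero divisors, that identity is first proved for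
  the matrix \<open>X I + A\<close> over the polynomial ring, whose determinant is monic and can be cancelled,
  and then specialised to \<open>X = 0\<close>. The cases \<open>k = 0\<close> and \<open>k = 1\<close> hold trivially.
\<close>

section \<open>The Desnanot--Jacobi identity\<close>

lemma det_unit_middle_columns:
  fixes B :: "'a::comm_ring_1 mat"
  assumes B: "B \<in> carrier_mat (Suc (Suc m)) (Suc (Suc m))"
    and mid: "\<And>i j. i \<le> Suc m \<Longrightarrow> 0 < j \<Longrightarrow> j \<le> m \<Longrightarrow> B $$ (i, j) = (if i = j then 1 else 0)"
  shows "det B = B $$ (0, 0) * B $$ (Suc m, Suc m) - B $$ (0, Suc m) * B $$ (Suc m, 0)"
proof -
  let ?C = "mat_delete B 0 0" and ?D = "mat_delete B 0 (Suc m)"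
  have C: "?C \<in> carrier_mat (Suc m) (Suc m)" and D: "?D \<in> carrier_mat (Suc m) (Suc m)"
    using mat_delete_carrier[OF B] by auto
  have "det B = (\<Sum>j<Suc (Suc m). B $$ (0, j) * cofactor B 0 j)"
    by (rule laplace_expansion_row[OF B]) simp
  also have "\<dots> = (\<Sum>j\<in>{0, Suc m}. B $$ (0, j) * cofactor B 0 j)"
    by (rule sum.mono_neutral_right) (auto simp: mid)
  finally have *: "det B = B $$ (0, 0) * cofactor B 0 0 + B $$ (0, Suc m) * cofactor B 0 (Suc m)"
    by simp
  have "det ?C = prod_list (diag_mat ?C)"
  proof (rule det_upper_triangular[OF _ C], rule upper_triangularI)
    fix i j assume "j < i" "i < dim_row ?C"
    then show "?C $$ (i, j) = 0"
      using B by (simp add: mat_delete_def mid)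
  qed
  also have "\<dots> = (\<Prod>i<Suc m. B $$ (Suc i, Suc i))"
    using B C by (simp add: prod_list_diag_prod mat_delete_def atLeast0LessThan)
  also have "\<dots> = B $$ (Suc m, Suc m)"
    by (simp add: mid)
  finally have detC: "det ?C = B $$ (Suc m, Suc m)" .
  have "det ?D = (\<Sum>j<Suc m. ?D $$ (m, j) * cofactor ?D m j)"
    by (rule laplace_expansion_row[OF D]) simp
  also have "\<dots> = (\<Sum>j\<in>{0}. ?D $$ (m, j) * cofactor ?D m j)"
    by (rule sum.mono_neutral_right) (use B in \<open>auto simp: mid mat_delete_def\<close>)
  also have "\<dots> = B $$ (Suc m, 0) * cofactor ?D m 0"
    using B by (simp add: mat_delete_def)
  also have "mat_delete ?D m 0 = 1\<^sub>m m"
    using B by (intro eq_matI) (auto simp: mat_delete_def mid)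
  then have "cofactor ?D m 0 = (-1) ^ m"
    by (simp add: cofactor_def)
  finally have detD: "det ?D = B $$ (Suc m, 0) * (-1) ^ m" .
  have "cofactor B 0 (Suc m) = - ((-1) ^ m * (-1) ^ m) * B $$ (Suc m, 0)"
    by (simp only: cofactor_def detD) (simp add: ac_simps)
  also have "(-1) ^ m * (-1) ^ m = (1::'a)"
    by (simp flip: power_mult_distrib)
  finally show ?thesis
    unfolding * by (simp add: cofactor_def detC)
qed

lemma det_scaled_unit_outer_columns:
  fixes B :: "'a::comm_ring_1 mat"
  assumes B: "B \<in> carrier_mat (Suc (Suc m)) (Suc (Suc m))"
    and first: "\<And>i. i \<le> Suc m \<Longrightarrow> B $$ (i, 0) = (if i = 0 then d else 0)"
    and last: "\<And>i. i \<le> Suc m \<Longrightarrow> B $$ (i, Suc m) = (if i = Suc m then d else 0)"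
  shows "det B = d * d * det (mat m m (\<lambda>(i, j). B $$ (Suc i, Suc j)))"
proof -
  let ?C = "mat_delete B 0 0"
  have C: "?C \<in> carrier_mat (Suc m) (Suc m)"
    using mat_delete_carrier[OF B] by auto
  have "det B = (\<Sum>i<Suc (Suc m). B $$ (i, 0) * cofactor B i 0)"
    by (rule laplace_expansion_column[OF B]) simp
  also have "\<dots> = (\<Sum>i\<in>{0}. B $$ (i, 0) * cofactor B i 0)"
    by (rule sum.mono_neutral_right) (auto simp: first)
  also have "\<dots> = d * det ?C"
    by (simp add: first cofactor_def)
  also have "det ?C = (\<Sum>i<Suc m. ?C $$ (i, m) * cofactor ?C i m)"
    by (rule laplace_expansion_column[OF C]) simp
  also have "\<dots> = (\<Sum>i\<in>{m}. ?C $$ (i, m) * cofactor ?C i m)"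
    by (rule sum.mono_neutral_right) (use B in \<open>auto simp: last mat_delete_def\<close>)
  also have "\<dots> = d * det (mat_delete ?C m m)"
    using B by (simp add: last mat_delete_def cofactor_def)
  also have "mat_delete ?C m m = mat m m (\<lambda>(i, j). B $$ (Suc i, Suc j))"
    using B by (intro eq_matI) (auto simp: mat_delete_def)
  finally show ?thesis
    by (simp add: mult.assoc)
qed

text \<open>
  The Desnanot--Jacobi identity when \<open>det A\<close> may be cancelled. Let \<open>B\<close> be the identity matrix with
  its first and last columns replaced by those of the adjugate of \<open>A\<close>. Then \<open>A * B\<close> is \<open>A\<close> with its
  first and last columns replaced by \<open>det A\<close> times the corresponding unit vectors, so that
  \<open>det A * det B\<close> is \<open>(det A)\<^sup>2\<close> times the interior minor, while \<open>det B\<close> is a two by two minor of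
  the adjugate.
\<close>

lemma desnanot_jacobi_regular:
  fixes A :: "'a::comm_ring_1 mat"
  assumes A: "A \<in> carrier_mat (Suc (Suc m)) (Suc (Suc m))"
    and regular: "\<And>x y. det A * x = det A * y \<Longrightarrow> x = y"
  shows "det A * det (mat m m (\<lambda>(i, j). A $$ (Suc i, Suc j)))
    = det (mat_delete A 0 0) * det (mat_delete A (Suc m) (Suc m))
      - det (mat_delete A 0 (Suc m)) * det (mat_delete A (Suc m) 0)"
proof -
  define n where "n = Suc (Suc m)"
  define B where "B = mat n n (\<lambda>(i, j). if j = 0 \<or> j = Suc m then adj_mat A $$ (i, j)
    else if i = j then 1 else 0)"
  have A': "A \<in> carrier_mat n n" and B: "B \<in> carrier_mat n n"
    using A by (auto simp: n_def B_def)
  have AB: "A * B \<in> carrier_mat n n"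
    using A' B by simp
  have outer: "(A * B) $$ (i, j) = (if i = j then det A else 0)"
    if "i < n" "j < n" "j = 0 \<or> j = Suc m" for i j
  proof -
    have "col B j = col (adj_mat A) j"
      using that adj_mat(1)[OF A'] by (intro eq_vecI) (auto simp: B_def)
    then have "(A * B) $$ (i, j) = (A * adj_mat A) $$ (i, j)"
      using that A' B adj_mat(1)[OF A'] by simp
    also have "\<dots> = (if i = j then det A else 0)"
      using that by (simp add: adj_mat(2)[OF A'])
    finally show ?thesis .
  qed
  have inner: "(A * B) $$ (i, j) = A $$ (i, j)" if "i < n" "0 < j" "j \<le> m" for i j
  proof -
    have "col B j = unit_vec n j"
      using that by (intro eq_vecI) (auto simp: B_def n_def unit_vec_def)
    then show ?thesis
      using that A' B by (simp add: n_def)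
  qed
  have "det A * det B = det (A * B)"
    by (rule det_mult[OF A' B, symmetric])
  also have "\<dots> = det A * det A * det (mat m m (\<lambda>(i, j). (A * B) $$ (Suc i, Suc j)))"
    by (rule det_scaled_unit_outer_columns[OF AB[unfolded n_def]])
      (simp_all add: outer n_def del: index_mult_mat)
  also have "mat m m (\<lambda>(i, j). (A * B) $$ (Suc i, Suc j)) = mat m m (\<lambda>(i, j). A $$ (Suc i, Suc j))"
    by (rule cong_mat) (simp_all add: inner n_def del: index_mult_mat)
  finally have "det B = det A * det (mat m m (\<lambda>(i, j). A $$ (Suc i, Suc j)))"
    by (intro regular[of "det B"]) (simp add: mult.assoc)
  moreover have "det B = B $$ (0, 0) * B $$ (Suc m, Suc m) - B $$ (0, Suc m) * B $$ (Suc m, 0)"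
    by (rule det_unit_middle_columns[OF B[unfolded n_def]]) (auto simp: B_def n_def)
  moreover have "\<dots> = det (mat_delete A 0 0) * det (mat_delete A (Suc m) (Suc m))
      - ((-1) ^ Suc m * (-1) ^ Suc m) * (det (mat_delete A (Suc m) 0) * det (mat_delete A 0 (Suc m)))"
    using A' by (simp add: B_def n_def adj_mat_def cofactor_def ac_simps)
  moreover have "(-1) ^ Suc m * (-1) ^ Suc m = (1::'a)"
    by (simp flip: power_mult_distrib)
  ultimately show ?thesis
    by (simp add: mult.commute)
qed

lemma monic_mult_cancel:
  fixes p q r :: "'a::comm_ring_1 poly"
  assumes monic: "lead_coeff p = 1" and eq: "p * q = p * r"
  shows "q = r"
proof (rule ccontr)
  assume "q \<noteq> r"
  then have "lead_coeff (q - r) \<noteq> 0"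
    by (simp only: leading_coeff_0_iff right_minus_eq not_False_eq_True)
  moreover have "coeff (p * (q - r)) (degree p + degree (q - r)) = lead_coeff (q - r)"
    by (simp only: coeff_mult_degree_sum monic mult_1_left)
  ultimately show False
    using eq by (simp add: right_diff_distrib)
qed

theorem desnanot_jacobi:
  fixes A :: "'a::comm_ring_1 mat"
  assumes A: "A \<in> carrier_mat (Suc (Suc m)) (Suc (Suc m))"
  shows "det A * det (mat m m (\<lambda>(i, j). A $$ (Suc i, Suc j)))
    = det (mat_delete A 0 0) * det (mat_delete A (Suc m) (Suc m))
      - det (mat_delete A 0 (Suc m)) * det (mat_delete A (Suc m) 0)"
proof -
  define n where "n = Suc (Suc m)"
  \<comment> \<open>\<open>P\<close> is \<open>X I + A\<close>, whose determinant is a monic polynomial and hence regular; evaluation at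
    \<open>X = 0\<close> recovers \<open>A\<close>.\<close>
  define P where "P = char_poly_matrix (- A)"
  have nA: "- A \<in> carrier_mat n n"
    using A by (simp add: n_def)
  have P: "P \<in> carrier_mat n n"
    unfolding P_def using nA by (rule char_poly_matrix_closed)
  have "lead_coeff (det P) = 1"
    using degree_monic_char_poly[OF nA] by (simp add: P_def char_poly_def)
  then have "\<And>x y. det P * x = det P * y \<Longrightarrow> x = y"
    by (rule monic_mult_cancel)
  note dj = desnanot_jacobi_regular[OF P[unfolded n_def] this]
  have eval: "comm_ring_hom (\<lambda>p::'a poly. poly p 0)"
    by unfold_locales simp_all
  let ?h = "map_mat (\<lambda>p::'a poly. poly p 0)"
  have h: "?h P = A"
    using A by (intro eq_matI) (auto simp: P_def char_poly_matrix_def)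
  have h_del: "?h (mat_delete P i j) = mat_delete (?h P) i j"
    if "i < n" "j < n" for i j
    using P that by (intro eq_matI) (auto simp: mat_delete_def)
  have h_int: "?h (mat m m (\<lambda>(i, j). P $$ (Suc i, Suc j))) = mat m m (\<lambda>(i, j). ?h P $$ (Suc i, Suc j))"
    using P by (intro eq_matI) (auto simp: n_def)
  show ?thesis
    using arg_cong[OF dj, of "\<lambda>p. poly p 0"]
    by (simp add: comm_ring_hom.hom_det[OF eval, symmetric] h_del h_int h n_def)
qed

section \<open>The Vandermonde determinant\<close>

text \<open>
  The Vandermonde matrix times the unitriangular matrix of the coefficients of the Newton
  polynomials \<open>\<Prod>l<j. (X - x\<^sub>l)\<close> is the matrix of the values of these polynomials at the nodes
  \<open>x\<^sub>i\<close>, which is lower triangular. This argument needs no division.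
\<close>

theorem det_vandermonde:
  fixes x :: "nat \<Rightarrow> 'a::comm_ring_1"
  shows "det (mat n n (\<lambda>(i, j). x i ^ j)) = (\<Prod>j<n. \<Prod>i<j. x j - x i)"
proof -
  define p where "p j = (\<Prod>l<j. [:- x l, 1:])" for j
  define V where "V = mat n n (\<lambda>(i, j). x i ^ j)"
  define U where "U = mat n n (\<lambda>(l, j). coeff (p j) l)"
  have p_Suc: "p (Suc j) = p j * [:- x j, 1:]" for j
    by (simp add: p_def)
  have deg: "degree (p j) \<le> j \<and> coeff (p j) j = 1" for j
  proof (induction j)
    case 0
    show ?case by (simp add: p_def)
  next
    case (Suc j)
    then have "coeff (p j) (Suc j) = 0"
      by (intro coeff_eq_0) simp
    moreover have "degree (p (Suc j)) \<le> Suc j"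
      unfolding p_Suc using Suc degree_mult_le[of "p j" "[:- x j, 1:]"] by simp
    ultimately show ?case
      using Suc by (simp add: p_Suc coeff_pCons)
  qed
  have V: "V \<in> carrier_mat n n" and U: "U \<in> carrier_mat n n"
    by (simp_all add: V_def U_def)
  have poly_p: "poly (p j) y = (\<Prod>l<j. y - x l)" for j y
    by (simp add: p_def poly_prod)
  have VU: "(V * U) $$ (i, j) = (\<Prod>l<j. x i - x l)" if "i < n" "j < n" for i j
  proof -
    have "(V * U) $$ (i, j) = (\<Sum>l<n. x i ^ l * coeff (p j) l)"
      using that by (simp add: V_def U_def scalar_prod_def atLeast0LessThan)
    also have "\<dots> = (\<Sum>l\<le>degree (p j). x i ^ l * coeff (p j) l)"
    proof (rule sum.mono_neutral_right)
      show "{..degree (p j)} \<subseteq> {..<n}"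
        using deg[of j] that by auto
    qed (auto simp: coeff_eq_0 not_le)
    also have "\<dots> = poly (p j) (x i)"
      by (simp add: poly_altdef mult.commute)
    finally show ?thesis
      by (simp add: poly_p)
  qed
  have "det U = prod_list (diag_mat U)"
  proof (rule det_upper_triangular[OF _ U], rule upper_triangularI)
    fix i j assume "j < i" "i < dim_row U"
    then show "U $$ (i, j) = 0"
      using deg[of j] by (simp add: U_def coeff_eq_0)
  qed
  also have "\<dots> = 1"
    using deg by (simp add: prod_list_diag_prod U_def)
  finally have "det U = 1" .
  moreover have "det (V * U) = prod_list (diag_mat (V * U))"
  proof (rule det_lower_triangular)
    fix i j assume "i < j" "j < n"
    then have "(V * U) $$ (i, j) = (\<Prod>l<j. x i - x l)"
      by (intro VU) simp_all
    also have "\<dots> = 0"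
      using \<open>i < j\<close> by (intro prod_zero) auto
    finally show "(V * U) $$ (i, j) = 0" .
  qed (use V U in simp)
  moreover have "\<dots> = (\<Prod>j<n. (V * U) $$ (j, j))"
    using V U by (simp add: prod_list_diag_prod atLeast0LessThan)
  moreover have "\<dots> = (\<Prod>j<n. \<Prod>i<j. x j - x i)"
    by (rule prod.cong) (simp_all add: VU del: index_mult_mat)
  ultimately show ?thesis
    using det_mult[OF V U] by (simp add: V_def)
qed

section \<open>Iterated residues of Laurent polynomials against formal distributions\<close>

lemma foldr_res:
  assumes "distinct xs" "\<And>x. x \<in> set xs \<Longrightarrow> Poly_Mapping.lookup e x = 0"
  shows "foldr res xs F e = F (e + (\<Sum>x\<in>set xs. Poly_Mapping.single x (-1)))"
  using assms
proof (induction xs arbitrary: e)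
  case (Cons x xs)
  have "foldr res (x # xs) F e = foldr res xs F (e + Poly_Mapping.single x (-1))"
    using Cons.prems by (simp add: res_def)
  also have "\<dots> = F (e + Poly_Mapping.single x (-1) + (\<Sum>y\<in>set xs. Poly_Mapping.single y (-1)))"
  proof (rule Cons.IH)
    fix y assume "y \<in> set xs"
    then show "Poly_Mapping.lookup (e + Poly_Mapping.single x (-1)) y = 0"
      using Cons.prems by (auto simp: lookup_add lookup_single when_def)
  qed (use Cons.prems in simp)
  finally show ?case
    using Cons.prems by (simp add: add.assoc)
qed simp

lemma iterated_res_eq: "iterated_res k F = F (\<Sum>i=1..k. Poly_Mapping.single i (-1))"
  using foldr_res[of "[1..<Suc k]" 0 F]
  by (simp add: iterated_res_def atLeastLessThanSuc_atLeastAtMost del: upt_Suc)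

lemma dist_mult_superset:
  assumes "finite K" "Poly_Mapping.keys p \<subseteq> K"
  shows "dist_mult p F e = (\<Sum>d\<in>K. Poly_Mapping.lookup p d * F (e - d))"
  unfolding dist_mult_def
  using assms by (intro sum.mono_neutral_left) (auto simp: in_keys_iff)

lemma dist_mult_add: "dist_mult (p + q) F e = dist_mult p F e + dist_mult q F e"
proof -
  let ?K = "Poly_Mapping.keys p \<union> Poly_Mapping.keys q"
  have "dist_mult (p + q) F e = (\<Sum>d\<in>?K. Poly_Mapping.lookup (p + q) d * F (e - d))"
    by (intro dist_mult_superset keys_add) simp
  also have "\<dots> = dist_mult p F e + dist_mult q F e"
    by (subst (1 2) dist_mult_superset[of ?K]) (simp_all add: lookup_add distrib_right sum.distrib)
  finally show ?thesis .
qed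

lemma dist_mult_sum: "dist_mult (\<Sum>s\<in>S. p s) F e = (\<Sum>s\<in>S. dist_mult (p s) F e)"
proof (induction S rule: infinite_finite_induct)
  case (insert s S)
  then show ?case by (simp add: dist_mult_add)
qed (simp_all add: dist_mult_def)

lemma dist_mult_single: "dist_mult (Poly_Mapping.single d a) F e = a * F (e - d)"
  by (subst dist_mult_superset[of "{d}"]) simp_all

lemma lookup_sum_single:
  assumes "finite S"
  shows "Poly_Mapping.lookup (\<Sum>i\<in>S. Poly_Mapping.single i (h i)) j = (if j \<in> S then h j else 0)"
  using assms by (simp add: lookup_sum lookup_single when_def)

text \<open>
  The linear functional on Laurent polynomials that sends \<open>p\<close> to the iterated residue of
  \<open>p * C\<^sup>(\<^sup>\<alpha>\<^sup>)(w\<^sub>1) \<cdots> C\<^sup>(\<^sup>\<alpha>\<^sup>)(w\<^sub>k)\<close>. On monomials in \<open>w\<^sub>1, \<dots>, w\<^sub>k\<close> it replaces each factor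
  \<open>w\<^sub>i\<^sup>n\<close> by the moment \<open>c\<^bsub>\<alpha>+n\<^esub>\<close>, also when \<open>n = 0\<close>.
\<close>

definition moment_functional :: "nat \<Rightarrow> (int \<Rightarrow> 'a::comm_ring_1) \<Rightarrow> int \<Rightarrow> 'a laurent_poly \<Rightarrow> 'a" where
  "moment_functional k c \<alpha> p = iterated_res k (dist_mult p (dist_prod k (Cseries c \<alpha>)))"

lemma moment_functional_sum:
  "moment_functional k c \<alpha> (\<Sum>s\<in>S. p s) = (\<Sum>s\<in>S. moment_functional k c \<alpha> (p s))"
  by (simp add: moment_functional_def iterated_res_eq dist_mult_sum)

text \<open>Sums over \<open>i < k\<close> match the indexing of matrices from \<open>0\<close>: row \<open>i\<close> belongs to \<open>w\<^bsub>i+1\<^esub>\<close>.\<close>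

lemma moment_functional_monomial:
  "moment_functional k c \<alpha> (Poly_Mapping.single (\<Sum>i<k. Poly_Mapping.single (Suc i) (g i)) a)
    = a * (\<Prod>i<k. c (\<alpha> + g i))"
proof -
  define e where "e = (\<Sum>i=1..k. Poly_Mapping.single i (- 1 - g (i - 1)))"
  have e_eq: "(\<Sum>i=1..k. Poly_Mapping.single i (- 1)) - (\<Sum>i<k. Poly_Mapping.single (Suc i) (g i)) = e"
    by (simp add: e_def sum.atLeast1_atMost_eq sum_subtractf single_diff)
  have lookup_e: "Poly_Mapping.lookup e j = (if j \<in> {1..k} then - 1 - g (j - 1) else 0)" for j
    unfolding e_def by (rule lookup_sum_single) simp
  have "dist_prod k (Cseries c \<alpha>) e = (\<Prod>i=1..k. Cseries c \<alpha> (Poly_Mapping.lookup e i))"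
    using lookup_e by (auto simp: dist_prod_def in_keys_iff split: if_splits)
  also have "\<dots> = (\<Prod>i=1..k. c (\<alpha> + g (i - 1)))"
    by (rule prod.cong) (simp_all add: lookup_e Cseries_def add.commute)
  also have "\<dots> = (\<Prod>i<k. c (\<alpha> + g i))"
    by (simp add: prod.atLeast1_atMost_eq)
  finally show ?thesis
    by (simp only: moment_functional_def iterated_res_eq dist_mult_single e_eq)
qed

lemma wvar_power: "wvar i ^ n = Poly_Mapping.single (Poly_Mapping.single i (int n)) 1"
  by (induction n) (simp_all add: wvar_def mult_single flip: single_add)

lemma prod_wvar_power:
  "(\<Prod>i<k. wvar (Suc i) ^ g i)
    = Poly_Mapping.single (\<Sum>i<k. Poly_Mapping.single (Suc i) (int (g i))) (1::'a::comm_ring_1)"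
  by (induction k) (simp_all add: wvar_power mult_single)

lemma of_int_mult_single:
  "of_int n * Poly_Mapping.single d a = Poly_Mapping.single d (of_int n * (a::'a::ring_1))"
  by (simp add: mult_single flip: single_of_int)

section \<open>The tau-functions as Hankel determinants\<close>

lemma inverse_of_nat_mult:
  assumes "n > 0"
  shows "of_nat n * inverse_of_nat n = (1::'a::comm_rat_algebra)"
proof -
  obtain m where n: "n = Suc m"
    using assms gr0_implies_Suc by blast
  obtain u :: 'a where u: "1 = of_nat n * u"
    unfolding n using of_nat_Suc_dvd_one by (rule dvdE)
  have "inverse_of_nat n = u"
    unfolding inverse_of_nat_def
  proof (rule the_equality)
    fix v :: 'a assume "of_nat n * v = 1"
    then show "v = u"
      by (metis u mult.left_commute mult.right_neutral)
  qed (use u in simp)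
  then show ?thesis
    using u by simp
qed

text \<open>
  The square of the Vandermonde determinant is the sum over pairs of permutations \<open>p\<close>, \<open>q\<close> of
  \<open>sign p * sign q\<close> times the monomial with exponents \<open>p i + q i\<close>. Applying the functional and
  replacing \<open>q\<close> by \<open>q \<circ> p\<close> turns the sum over \<open>q\<close> into the Hankel determinant, for each \<open>p\<close>.
\<close>

lemma moment_functional_det_square:
  fixes c :: "int \<Rightarrow> 'a::comm_ring_1" and \<alpha> :: int and k :: nat
  defines "V \<equiv> mat k k (\<lambda>(i, j). wvar (Suc i) ^ j :: 'a laurent_poly)"
    and "H \<equiv> mat k k (\<lambda>(i, j). c (\<alpha> + int i + int j))"
  shows "moment_functional k c \<alpha> (det V * det V) = of_nat (fact k) * det H"
proof -
  let ?S = "{p. p permutes {0..<k}}"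
  have V: "V \<in> carrier_mat k k" and H: "H \<in> carrier_mat k k"
    by (simp_all add: V_def H_def)
  have entry: "(\<Prod>i=0..<k. V $$ (i, p i)) = (\<Prod>i<k. wvar (Suc i) ^ p i)" if "p \<in> ?S" for p
    using that by (intro prod.cong) (auto simp: V_def permutes_in_image)
  have detV: "det V = (\<Sum>p\<in>?S. signof p * (\<Prod>i<k. wvar (Suc i) ^ p i))"
    unfolding det_def'[OF V] by (intro sum.cong refl) (simp add: entry)
  have "det V * det V = (\<Sum>p\<in>?S. \<Sum>q\<in>?S. of_int (sign p * sign q) * (\<Prod>i<k. wvar (Suc i) ^ (p i + q i)))"
    unfolding detV sum_product
    by (intro sum.cong refl) (simp add: power_add prod.distrib mult_ac)
  then have "moment_functional k c \<alpha> (det V * det V)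
    = (\<Sum>p\<in>?S. \<Sum>q\<in>?S. of_int (sign p * sign q) * (\<Prod>i<k. c (\<alpha> + int (p i + q i))))"
    by (simp only: moment_functional_sum prod_wvar_power of_int_mult_single mult_1_right
        moment_functional_monomial)
  also have "\<dots> = (\<Sum>p\<in>?S. det H)"
  proof (rule sum.cong[OF refl])
    fix p assume "p \<in> ?S"
    then have p: "p permutes {0..<k}" by simp
    then have perm_p: "permutation p"
      by (auto simp: permutation_permutes)
    have "(\<Sum>q\<in>?S. of_int (sign p * sign q) * (\<Prod>i<k. c (\<alpha> + int (p i + q i))))
        = (\<Sum>q\<in>?S. of_int (sign p * sign (q \<circ> p)) * (\<Prod>i<k. c (\<alpha> + int (p i + (q \<circ> p) i))))"
      by (rule sum_permutations_compose_right[OF p])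
    also have "\<dots> = (\<Sum>q\<in>?S. signof q * (\<Prod>i=0..<k. H $$ (i, q i)))"
    proof (rule sum.cong[OF refl])
      fix q assume "q \<in> ?S"
      then have q: "q permutes {0..<k}" by simp
      then have "permutation q"
        by (auto simp: permutation_permutes)
      then have "sign p * sign (q \<circ> p) = sign q"
        using perm_p by (simp add: sign_compose mult.commute[of "sign q" "sign p"]
            flip: mult.assoc)
      moreover have "(\<Prod>i<k. c (\<alpha> + int (p i + (q \<circ> p) i))) = (\<Prod>i=0..<k. H $$ (p i, q (p i)))"
      proof (rule prod.cong)
        fix i assume "i \<in> {0..<k}"
        then have "p i < k" "q (p i) < k"
          using permutes_in_image[OF p, of i] permutes_in_image[OF q, of "p i"] by simp_all
        then show "c (\<alpha> + int (p i + (q \<circ> p) i)) = H $$ (p i, q (p i))"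
          by (simp add: H_def add.assoc)
      qed auto
      moreover have "\<dots> = (\<Prod>i=0..<k. H $$ (i, q i))"
        using prod.permute[OF p, of "\<lambda>i. H $$ (i, q i)"] by (simp only: comp_def)
      ultimately show "of_int (sign p * sign (q \<circ> p)) * (\<Prod>i<k. c (\<alpha> + int (p i + (q \<circ> p) i)))
          = signof q * (\<Prod>i=0..<k. H $$ (i, q i))"
        by simp
    qed
    also have "\<dots> = det H"
      by (rule det_def'[OF H, symmetric])
    finally show "(\<Sum>q\<in>?S. of_int (sign p * sign q) * (\<Prod>i<k. c (\<alpha> + int (p i + q i)))) = det H" .
  qed
  also have "\<dots> = of_nat (fact k) * det H"
    by (simp add: card_permutations[of _ k])
  finally show ?thesis .
qed

lemma prod_square_diff_eq_det_square:
  fixes w :: "nat \<Rightarrow> 'a::comm_ring_1" and k :: nat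
  defines "V \<equiv> mat k k (\<lambda>(i, j). w (Suc i) ^ j)"
  shows "(\<Prod>(i, j)\<in>{(i, j). 1 \<le> i \<and> i < j \<and> j \<le> k}. (w i - w j)\<^sup>2) = det V * det V"
proof -
  let ?T = "SIGMA j:{..<k}. {..<j}"
  have "(\<Prod>(i, j)\<in>{(i, j). 1 \<le> i \<and> i < j \<and> j \<le> k}. (w i - w j)\<^sup>2)
      = (\<Prod>(j, i)\<in>?T. (w (Suc j) - w (Suc i))\<^sup>2)"
  proof (rule prod.reindex_bij_witness[where i = "\<lambda>(j, i). (Suc i, Suc j)" and j = "\<lambda>(i, j). (j - 1, i - 1)"])
  qed (auto simp: power2_commute)
  also have "\<dots> = (\<Prod>j<k. \<Prod>i<j. (w (Suc j) - w (Suc i))\<^sup>2)"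
    by (simp add: prod.Sigma)
  also have "\<dots> = (det V)\<^sup>2"
    using det_vandermonde[of k "\<lambda>i. w (Suc i)"] by (simp add: V_def prod_power_distrib)
  finally show ?thesis
    by (simp add: power2_eq_square)
qed

theorem tau_eq_hankel_det:
  "tau c \<alpha> (int n) = det (mat n n (\<lambda>(i, j). c (\<alpha> + int i + int j)))"
proof (cases "n = 0")
  case True
  then show ?thesis by (simp add: tau_def)
next
  case False
  let ?H = "mat n n (\<lambda>(i, j). c (\<alpha> + int i + int j))"
  have "tau c \<alpha> (int n) = inverse_of_nat (fact n) * (of_nat (fact n) * det ?H)"
    using False
    by (simp only: tau_def prod_square_diff_eq_det_square moment_functional_det_square
        flip: moment_functional_def) simp
  also have "\<dots> = (of_nat (fact n) * inverse_of_nat (fact n)) * det ?H"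
    by (simp add: ac_simps)
  finally show ?thesis
    by (simp only: inverse_of_nat_mult[OF fact_gt_zero] mult_1_left)
qed

section \<open>The recursion for the tau-functions\<close>

theorem mainTheorem1:
  fixes c :: "int \<Rightarrow> 'a::comm_rat_algebra" and k \<alpha> :: int
  assumes "k \<ge> 0"
  shows "tau c \<alpha> k * tau c (\<alpha> + 2) (k - 2)
    = tau c (\<alpha> + 2) (k - 1) * tau c \<alpha> (k - 1) - (tau c (\<alpha> + 1) (k - 1))\<^sup>2"
proof -
  consider "k = 0" | "k = 1" | m where "k = int (Suc (Suc m))"
  proof -
    have "k = 0 \<or> k = 1 \<or> k = int (Suc (Suc (nat (k - 2))))"
      using assms by linarith
    then show ?thesis
      using that by blast
  qed
  then show ?thesis
  proof cases
    case 1
    then show ?thesis by (simp add: tau_def)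
  next
    case 2
    then show ?thesis by (simp add: tau_def)
  next
    case (3 m)
    define H where "H \<beta> n = mat n n (\<lambda>(i, j). c (\<beta> + int i + int j))" for \<beta> n
    let ?A = "H \<alpha> (Suc (Suc m))"
    have tau_H: "tau c \<beta> (int n) = det (H \<beta> n)" for \<beta> n
      by (simp only: tau_eq_hankel_det H_def)
    have k1: "k - 1 = int (Suc m)" and k2: "k - 2 = int m"
      using 3 by simp_all
    have A: "?A \<in> carrier_mat (Suc (Suc m)) (Suc (Suc m))"
      by (simp add: H_def)
    have interior: "mat m m (\<lambda>(i, j). ?A $$ (Suc i, Suc j)) = H (\<alpha> + 2) m"
      by (rule eq_matI) (simp_all add: H_def algebra_simps)
    have first_first: "mat_delete ?A 0 0 = H (\<alpha> + 2) (Suc m)"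
      by (rule eq_matI) (simp_all add: H_def mat_delete_def algebra_simps)
    have last_last: "mat_delete ?A (Suc m) (Suc m) = H \<alpha> (Suc m)"
      by (rule eq_matI) (simp_all add: H_def mat_delete_def)
    have first_last: "mat_delete ?A 0 (Suc m) = H (\<alpha> + 1) (Suc m)"
      by (rule eq_matI) (simp_all add: H_def mat_delete_def algebra_simps)
    have last_first: "mat_delete ?A (Suc m) 0 = H (\<alpha> + 1) (Suc m)"
      by (rule eq_matI) (simp_all add: H_def mat_delete_def algebra_simps)
    show ?thesis
      unfolding k1 k2 unfolding 3 tau_H
      using desnanot_jacobi[OF A]
      by (simp only: interior first_first last_last first_last last_first power2_eq_square)
  qed
qed

end
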